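(* Let $\mathcal{D}\subset\mathbb{R}^3$ be the considered region and let $\mathcal{D}_i$, $i\in\mathcal{I}=\{1,\dots,M+MK\}$, be the blocked regions described in the context, the $i$-th blocked region being written $\mathcal{D}_i=\{\mathbf{x}\in\mathbb{R}^3 \mid \mathbf{a}_{ij}^{\mathrm T}\mathbf{x}-b_{ij}\le 0,\ \forall j\in\mathcal{J}_i\}$. Let $C$ be a sufficiently large constant. Then for each $i\in\mathcal{I}$, the condition $\mathbf{x}\in\mathcal{D}\setminus\mathcal{D}_i$ is equivalent to the following system in $\mathbf{x}$ and auxiliary binary variables $l_{ij}$, $j\in\mathcal{J}_i$ (that is, $\mathbf{x}\in\mathcal{D}\setminus\mathcal{D}_i$ if and only if there exist $l_{ij}$, $j\in\mathcal{J}_i$, for which the system holds): $$\begin{cases}\mathbf{a}_{ij}^{\mathrm T}\mathbf{x}-b_{ij}+C\,l_{ij}>0, & \forall j\in\mathcal{J}_i,\\ l_{ij}\in\{0,1\}, & \forall j\in\mathcal{J}_i,\\ \sum_{j\in\mathcal{J}_i} l_{ij}\le |\mathcal{J}_i|-1,\\ \mathbf{x}\in\mathcal{D}.\end{cases}$$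
   Context: Coordinates in $\mathbb{R}^3$ are (horizontal, horizontal, altitude). A UAV (unmanned aerial vehicle) is to be placed at a point $\mathbf{x}=(x_{\mathrm V},y_{\mathrm V},h_{\mathrm V})$ of the considered region $\mathcal{D}=\{(x_{\mathrm V},y_{\mathrm V},h_{\mathrm V}) \mid x_{\mathrm V}\in[0,x_{\mathrm D}],\ y_{\mathrm V}\in[0,y_{\mathrm D}],\ h_{\mathrm V}\ge h_{\min}\}$; the UAV is supposed to hover at an altitude above the tallest building. There are $M$ buildings, one base station and $K$ ground users. Each building is a cube (box) standing on the ground, with four vertical flank (side) surfaces and a horizontal top. The users are located at areas without buildings. Each of the $M$ buildings generates one blocked region with respect to the base station and one with respect to each of the $K$ users; these $M+MK$ blocked regions are indexed by $\mathcal{I}=\{1,\dots,M+MK\}$. Blocked region for a user at point $S$ and a building: a flank surface of the building is visible from $S$ if the inner product of its outward normal vector with the vector from $S$ to any point of the surface is negative, and invisible otherwise. The boundary of the blocked region consists of hyperplanes, indexed by a finite set $\mathcal{J}_i$, each determined by $S$ and two adjacent vertices of a flank surface: - one oblique hyperplane for each visible flank surface (there are one or two of them), through $S$ and the top edge of that surface; - two vertical hyperplanes, through $S$ and, respectively, the two outermost vertical edges of the union of the visible flank surfaces. So $|\mathcal{J}_i|$ equals three or four. For $j\in\mathcal{J}_i$, $\mathbf{a}_{ij}\in\mathbb{R}^3$ is the normal vector of hyperplane $j$ pointing to the outside of the blocked region, and $b_{ij}\in\mathbb{R}$ is the inner product of $\mathbf{a}_{ij}$ with any point of hyperplane $j$.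 The blocked region is the polyhedron $\mathcal{D}_i=\{\mathbf{x}\in\mathbb{R}^3 \mid \mathbf{a}_{ij}^{\mathrm T}\mathbf{x}-b_{ij}\le0,\ \forall j\in\mathcal{J}_i\}$. Blocked region for the base station and a building: if the base station antenna is lower than the building, the same construction is used with $S$ the base station position; if the antenna is higher than the building, the blocked region is the empty set, $\mathcal{D}_i=\emptyset$ (no particular hyperplanes are specified in this case).
   Formalization: When the antenna is higher than the building and the blocked region is empty, the hyperplanes, left unspecified in the source, are assumed to be finitely many with no normal pointing downwards; otherwise, e.g. for {z ≤ 0, −z ≤ −1}, no constant C suffices because altitude is unbounded. *)

theory Defs
  imports "HOL-Analysis.Analysis"
begin

text \<open>Components 1 and 2 of a point are horizontal, component 3 is the altitude; the ground is
  at altitude 0.\<close>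

definition considered_region :: "real \<Rightarrow> real \<Rightarrow> real \<Rightarrow> (real^3) set" where
  "considered_region xD yD hmin = {x. x $ 1 \<in> {0..xD} \<and> x $ 2 \<in> {0..yD} \<and> hmin \<le> x $ 3}"

text \<open>A box on the ground, in an arbitrary horizontal orientation: \<open>edge1\<close> and \<open>edge2\<close> are the
  edge vectors of the rectangular base at the vertex \<open>corner\<close>.\<close>

record building =
  corner :: "real^3"
  edge1 :: "real^3"
  edge2 :: "real^3"
  height :: real

definition is_building :: "building \<Rightarrow> bool" where
  "is_building B \<longleftrightarrow>
     corner B $ 3 = 0 \<and> edge1 B $ 3 = 0 \<and> edge2 B $ 3 = 0 \<and>
     edge1 B \<noteq> 0 \<and> edge2 B \<noteq> 0 \<and> edge1 B \<bullet> edge2 B = 0 \<and> 0 < height B"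

definition solid :: "building \<Rightarrow> (real^3) set" where
  "solid B = {corner B + s *\<^sub>R edge1 B + t *\<^sub>R edge2 B + r *\<^sub>R axis 3 1 | s t r.
     s \<in> {0..1} \<and> t \<in> {0..1} \<and> r \<in> {0..height B}}"

text \<open>Vertices and flank surfaces are numbered cyclically modulo 4. Flank \<open>n\<close> stands on the base
  edge from vertex \<open>n\<close> to vertex \<open>n + 1\<close>, so the vertical edge at vertex \<open>n\<close> is shared by the
  flanks \<open>n\<close> and \<open>n - 1\<close>, the latter written \<open>n + 3\<close>.\<close>

definition base_vertex :: "building \<Rightarrow> nat \<Rightarrow> real^3" where
  "base_vertex B n = corner B
     + (if n mod 4 \<in> {1, 2} then edge1 B else 0)
     + (if n mod 4 \<in> {2, 3} then edge2 B else 0)"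

definition top_vertex :: "building \<Rightarrow> nat \<Rightarrow> real^3" where
  "top_vertex B n = base_vertex B n + height B *\<^sub>R axis 3 1"

definition flank :: "building \<Rightarrow> nat \<Rightarrow> (real^3) set" where
  "flank B n = convex hull
     {base_vertex B n, base_vertex B (n + 1), top_vertex B n, top_vertex B (n + 1)}"

definition outward_normal :: "building \<Rightarrow> nat \<Rightarrow> real^3" where
  "outward_normal B n =
     (if n mod 4 = 0 then - edge2 B else if n mod 4 = 1 then edge1 B
      else if n mod 4 = 2 then edge2 B else - edge1 B)"

definition visible :: "building \<Rightarrow> real^3 \<Rightarrow> nat \<Rightarrow> bool" where
  "visible B S n \<longleftrightarrow> (\<forall>p\<in>flank B n. outward_normal B n \<bullet> (p - S) < 0)"

text \<open>The pairs of adjacent vertices that determine, together with \<open>S\<close>, the bounding hyperplanes: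
  the top edges of the visible flanks, and the two outermost vertical edges of the union of the
  visible flanks, which are the vertical edges belonging to exactly one visible flank.\<close>

definition bounding_edges :: "building \<Rightarrow> real^3 \<Rightarrow> ((real^3) \<times> (real^3)) set" where
  "bounding_edges B S =
     {(top_vertex B n, top_vertex B (n + 1)) | n. n < 4 \<and> visible B S n} \<union>
     {(base_vertex B n, top_vertex B n) | n. n < 4 \<and> visible B S n \<noteq> visible B S (n + 3)}"

definition shadow :: "building \<Rightarrow> real^3 \<Rightarrow> (real^3) set" where
  "shadow B S = {x. closed_segment S x \<inter> solid B \<noteq> {}}"

definition blocked_region :: "'j set \<Rightarrow> ('j \<Rightarrow> real^3) \<Rightarrow> ('j \<Rightarrow> real) \<Rightarrow> (real^3) set" where
  "blocked_region J a b = {x. \<forall>j\<in>J. a j \<bullet> x - b j \<le> 0}"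

text \<open>The normals are not normalized. Which side of a hyperplane is the outside is decided by the
  points that the building actually hides from \<open>S\<close>, since the polyhedron \<open>blocked_region J a b\<close> is
  itself defined by the oriented normals.\<close>

definition geometric_hyperplanes ::
  "building \<Rightarrow> real^3 \<Rightarrow> 'j set \<Rightarrow> ('j \<Rightarrow> real^3) \<Rightarrow> ('j \<Rightarrow> real) \<Rightarrow> bool" where
  "geometric_hyperplanes B S J a b \<longleftrightarrow>
     (\<exists>e. bij_betw e J (bounding_edges B S) \<and>
        (\<forall>j\<in>J. a j \<noteq> 0 \<and>
           {x. a j \<bullet> x = b j} = affine hull {S, fst (e j), snd (e j)} \<and>
           (\<forall>x\<in>shadow B S. a j \<bullet> x \<le> b j)))"

text \<open>If \<open>S\<close> is higher than the building, any finite system of inequalities describing the empty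
  set is admitted in which no normal points downwards. The hyperplanes of the other case have
  this property too; without it \<open>a j \<bullet> x - b j\<close> would be unbounded below on the considered region,
  whose altitude is unbounded, and no constant would be large enough.\<close>

definition blocking_hyperplanes ::
  "building \<Rightarrow> real^3 \<Rightarrow> 'j set \<Rightarrow> ('j \<Rightarrow> real^3) \<Rightarrow> ('j \<Rightarrow> real) \<Rightarrow> bool" where
  "blocking_hyperplanes B S J a b \<longleftrightarrow>
     (if height B < S $ 3
      then finite J \<and> blocked_region J a b = {} \<and> (\<forall>j\<in>J. 0 \<le> a j $ 3)
      else geometric_hyperplanes B S J a b)"

end

theory Submission imports Defs begin

text \<open>The big-M reformulation needs finitely many affine functions, each bounded below on the
  considered region. As the altitude is the only unbounded coordinate, this amounts to every normal
  having a nonnegative altitude component. For a hyperplane bounding a shadow this holds because it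
  contains a top vertex of the building, while the base vertex vertically below it is hidden and thus
  lies on the inner side.\<close>

lemma base_vertex_in_solid:
  assumes "0 \<le> height B"
  shows "base_vertex B n \<in> solid B"
  unfolding solid_def base_vertex_def
  by (intro CollectI exI[of _ "if n mod 4 \<in> {1, 2} then 1 else 0"]
      exI[of _ "if n mod 4 \<in> {2, 3} then 1 else 0"] exI[of _ 0]) (use assms in auto)

text \<open>The line of sight from \<open>S\<close> to a point of the building ends inside the
  building.\<close>

lemma solid_subset_shadow: "solid B \<subseteq> shadow B S"
  unfolding shadow_def by auto

lemma finite_bounding_edges: "finite (bounding_edges B S)"
  unfolding bounding_edges_def by simp

text \<open>A top edge has two top vertices, a vertical edge has one as its second endpoint, so the
  sign argument for the normals treats both kinds of hyperplane alike.\<close>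

lemma bounding_edge_contains_top_vertex:
  assumes "p \<in> bounding_edges B S"
  obtains n where "top_vertex B n \<in> {fst p, snd p}"
  using assms unfolding bounding_edges_def by fastforce

lemma geometric_hyperplanes_normal_nonneg:
  assumes "is_building B" and "geometric_hyperplanes B S J a b" and "j \<in> J"
  shows "0 \<le> a j $ 3"
proof -
  from assms obtain e where e: "bij_betw e J (bounding_edges B S)"
    and hull: "{x. a j \<bullet> x = b j} = affine hull {S, fst (e j), snd (e j)}"
    and inner: "\<forall>x\<in>shadow B S. a j \<bullet> x \<le> b j"
    unfolding geometric_hyperplanes_def by blast
  have h: "0 < height B"
    using assms(1) by (simp add: is_building_def)
  from bij_betwE[OF e] \<open>j \<in> J\<close> obtain n where "top_vertex B n \<in> {fst (e j), snd (e j)}"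
    using bounding_edge_contains_top_vertex by blast
  then have "top_vertex B n \<in> affine hull {S, fst (e j), snd (e j)}"
    by (intro hull_inc) auto
  then have "a j \<bullet> top_vertex B n = b j"
    using hull by blast
  moreover have "a j \<bullet> base_vertex B n \<le> b j"
    using inner solid_subset_shadow base_vertex_in_solid h by (meson less_imp_le subsetD)
  \<comment> \<open>The two vertices differ by \<open>height B\<close> in altitude only, so
    subtracting their inner products with \<open>a j\<close> leaves just this term.\<close>
  ultimately have "0 \<le> height B * a j $ 3"
    by (simp add: top_vertex_def inner_add_right inner_axis)
  then show ?thesis
    using h by (simp add: zero_le_mult_iff)
qed

lemma blocking_hyperplanes_finite:
  assumes "blocking_hyperplanes B S J a b"
  shows "finite J"
  using assms bij_betw_finite[THEN iffD2, OF _ finite_bounding_edges]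
  unfolding blocking_hyperplanes_def geometric_hyperplanes_def by (auto split: if_splits)

lemma blocking_hyperplanes_normal_nonneg:
  assumes "is_building B" and "blocking_hyperplanes B S J a b" and "j \<in> J"
  shows "0 \<le> a j $ 3"
  using assms geometric_hyperplanes_normal_nonneg
  unfolding blocking_hyperplanes_def by (auto split: if_splits)

text \<open>The horizontal coordinates range over bounded intervals, so \<open>v $ 1\<close> and
  \<open>v $ 2\<close> may have either sign; the altitude is bounded only from below, which is where
  the sign of \<open>v $ 3\<close> enters.\<close>

lemma inner_lower_bound_considered_region:
  assumes "0 \<le> v $ 3" and "x \<in> considered_region xD yD hmin"
  shows "- (\<bar>v $ 1\<bar> * \<bar>xD\<bar> + \<bar>v $ 2\<bar> * \<bar>yD\<bar> + v $ 3 * \<bar>hmin\<bar>) \<le> v \<bullet> x"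
proof -
  have x: "\<bar>x $ 1\<bar> \<le> \<bar>xD\<bar>" "\<bar>x $ 2\<bar> \<le> \<bar>yD\<bar>" "- \<bar>hmin\<bar> \<le> x $ 3"
    using assms(2) by (auto simp: considered_region_def)
  have "\<bar>v $ 1 * x $ 1\<bar> \<le> \<bar>v $ 1\<bar> * \<bar>xD\<bar>" "\<bar>v $ 2 * x $ 2\<bar> \<le> \<bar>v $ 2\<bar> * \<bar>yD\<bar>"
    using x by (simp_all add: abs_mult mult_left_mono)
  moreover have "v $ 3 * - \<bar>hmin\<bar> \<le> v $ 3 * x $ 3"
    using x(3) assms(1) by (rule mult_left_mono)
  moreover have "v \<bullet> x = v $ 1 * x $ 1 + v $ 2 * x $ 2 + v $ 3 * x $ 3"
    by (simp add: inner_vec_def sum_3)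
  ultimately show ?thesis
    by (simp add: abs_le_iff)
qed

text \<open>Setting \<open>l j = 1\<close> switches constraint \<open>j\<close> off, because
  \<open>C\<close> outweighs \<open>- f j\<close>; the cap on the sum keeps at least one constraint
  on. For empty \<open>J\<close> both sides are false: the subtraction is real, so the cap is -1
  while the sum is 0.\<close>

lemma big_M_disjunction:
  fixes f :: "'j \<Rightarrow> real"
  assumes "finite J" and bound: "\<And>j. j \<in> J \<Longrightarrow> 0 < f j + C"
  shows "(\<exists>j\<in>J. 0 < f j) \<longleftrightarrow>
    (\<exists>l :: 'j \<Rightarrow> real. (\<forall>j\<in>J. f j + C * l j > 0) \<and> (\<forall>j\<in>J. l j \<in> {0, 1}) \<and>
       (\<Sum>j\<in>J. l j) \<le> real (card J) - 1)"
proof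
  assume "\<exists>j\<in>J. 0 < f j"
  then obtain k where k: "k \<in> J" "0 < f k" by blast
  \<comment> \<open>Only the constraint known to hold stays on, so the cap is attained with
    equality.\<close>
  define l :: "'j \<Rightarrow> real" where "l j = (if j = k then 0 else 1)" for j
  have "(\<Sum>j\<in>J. l j) = (\<Sum>j\<in>J - {k}. l j)"
    using sum.remove[OF \<open>finite J\<close> k(1), of l] by (simp add: l_def)
  also have "\<dots> = real (card (J - {k}))"
    by (simp add: l_def)
  also have "\<dots> = real (card J) - 1"
    using card.remove[OF \<open>finite J\<close> k(1)] by simp
  finally show "\<exists>l :: 'j \<Rightarrow> real. (\<forall>j\<in>J. f j + C * l j > 0) \<and> (\<forall>j\<in>J. l j \<in> {0, 1}) \<and>
      (\<Sum>j\<in>J. l j) \<le> real (card J) - 1"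
    using k bound by (intro exI[of _ l]) (auto simp: l_def)
next
  assume "\<exists>l :: 'j \<Rightarrow> real. (\<forall>j\<in>J. f j + C * l j > 0) \<and> (\<forall>j\<in>J. l j \<in> {0, 1}) \<and>
      (\<Sum>j\<in>J. l j) \<le> real (card J) - 1"
  then obtain l :: "'j \<Rightarrow> real" where l: "\<forall>j\<in>J. f j + C * l j > 0" "\<forall>j\<in>J. l j \<in> {0, 1}"
    "(\<Sum>j\<in>J. l j) \<le> real (card J) - 1" by blast
  have "\<exists>k\<in>J. l k = 0"
  proof (rule ccontr)
    assume "\<not> (\<exists>k\<in>J. l k = 0)"
    then have "(\<Sum>j\<in>J. l j) = (\<Sum>j\<in>J. 1)"
      using l(2) by (intro sum.cong) auto
    then show False
      using l(3) by simp
  qed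
  then show "\<exists>j\<in>J. 0 < f j"
    using l(1) by force
qed

theorem theorem1:
  fixes M K :: nat
    and xD yD hmin :: real
    and bld :: "nat \<Rightarrow> building"
    and bs :: "real^3"
    and user :: "nat \<Rightarrow> real^3"
    and idx :: "nat \<Rightarrow> nat \<times> nat"
    and J :: "nat \<Rightarrow> nat set"
    and a :: "nat \<Rightarrow> nat \<Rightarrow> real^3"
    and b :: "nat \<Rightarrow> nat \<Rightarrow> real"
  assumes buildings: "\<forall>m\<in>{1..M}. is_building (bld m)"
    and above_buildings: "\<forall>m\<in>{1..M}. height (bld m) < hmin"
    and users: "\<forall>k\<in>{1..K}. user k $ 3 = 0 \<and> (\<forall>m\<in>{1..M}. user k \<notin> solid (bld m))"
    and indexing: "bij_betw idx {1..M + M * K} ({1..M} \<times> {0..K})"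
    and hyperplanes: "\<forall>i\<in>{1..M + M * K}. \<forall>m k. idx i = (m, k) \<longrightarrow>
          blocking_hyperplanes (bld m) (if k = 0 then bs else user k) (J i) (a i) (b i)"
  shows "\<exists>C0::real. \<forall>C\<ge>C0. \<forall>i\<in>{1..M + M * K}. \<forall>x.
           x \<in> considered_region xD yD hmin - blocked_region (J i) (a i) (b i) \<longleftrightarrow>
           (\<exists>l :: nat \<Rightarrow> real.
              (\<forall>j\<in>J i. a i j \<bullet> x - b i j + C * l j > 0) \<and>
              (\<forall>j\<in>J i. l j \<in> {0, 1}) \<and>
              (\<Sum>j\<in>J i. l j) \<le> real (card (J i)) - 1 \<and>
              x \<in> considered_region xD yD hmin)"
proof -
  let ?I = "{1..M + M * K}"
  let ?D = "considered_region xD yD hmin"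
  have J: "finite (J i)" "\<And>j. j \<in> J i \<Longrightarrow> 0 \<le> a i j $ 3" if "i \<in> ?I" for i
  proof -
    obtain m k where mk: "idx i = (m, k)" by fastforce
    then have B: "is_building (bld m)"
      using bij_betwE[OF indexing] that buildings by fastforce
    have H: "blocking_hyperplanes (bld m) (if k = 0 then bs else user k) (J i) (a i) (b i)"
      using hyperplanes that mk by blast
    show "finite (J i)"
      using H by (rule blocking_hyperplanes_finite)
    show "0 \<le> a i j $ 3" if "j \<in> J i" for j
      using B H that by (rule blocking_hyperplanes_normal_nonneg)
  qed
  \<comment> \<open>On the considered region \<open>- L i j\<close> bounds
    \<open>a i j \<bullet> x - b i j\<close> from below. The absolute value of
    \<open>a i j $ 3\<close> makes \<open>L\<close> nonnegative at all indices.\<close>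
  define L where "L i j = \<bar>a i j $ 1\<bar> * \<bar>xD\<bar> + \<bar>a i j $ 2\<bar> * \<bar>yD\<bar> + \<bar>a i j $ 3\<bar> * \<bar>hmin\<bar> + \<bar>b i j\<bar>"
    for i j
  have L_nonneg: "0 \<le> L i j" for i j
    by (simp add: L_def)
  \<comment> \<open>A sum of nonnegative terms dominates each of them, so one constant serves all
    regions at once, even if some index set is empty; the added 1 makes the bound strict.\<close>
  define C0 where "C0 = 1 + (\<Sum>i\<in>?I. \<Sum>j\<in>J i. L i j)"
  have L_less: "L i j < C0" if "i \<in> ?I" "j \<in> J i" for i j
  proof -
    have "L i j \<le> (\<Sum>j\<in>J i. L i j)"
      using that J L_nonneg by (intro member_le_sum) auto
    also have "\<dots> \<le> (\<Sum>i\<in>?I. \<Sum>j\<in>J i. L i j)"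
      by (rule member_le_sum) (use that(1) L_nonneg in \<open>auto intro: sum_nonneg\<close>)
    finally show ?thesis
      by (simp add: C0_def)
  qed
  have bound: "0 < a i j \<bullet> x - b i j + C"
    if "C0 \<le> C" "i \<in> ?I" "j \<in> J i" "x \<in> ?D" for C i j x
    using inner_lower_bound_considered_region[OF J(2)[OF that(2,3)] that(4)]
      L_less[OF that(2,3)] J(2)[OF that(2,3)] that(1) unfolding L_def by linarith
  show ?thesis
  proof (intro exI[of _ C0] allI impI ballI)
    fix C i x
    assume C: "C0 \<le> C" and i: "i \<in> ?I"
    have "x \<in> ?D - blocked_region (J i) (a i) (b i) \<longleftrightarrow>
        x \<in> ?D \<and> (\<exists>j\<in>J i. 0 < a i j \<bullet> x - b i j)"
      unfolding blocked_region_def by (auto simp: not_le)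
    moreover have "x \<in> ?D \<Longrightarrow> 0 < a i j \<bullet> x - b i j + C" if "j \<in> J i" for j
      using bound[OF C i that] .
    \<comment> \<open>The lower bound is available only for \<open>x\<close> in \<open>?D\<close>,
      so the equivalence is conditional; for other \<open>x\<close> both sides of the goal are
      false.\<close>
    then have "x \<in> ?D \<Longrightarrow> (\<exists>j\<in>J i. 0 < a i j \<bullet> x - b i j) \<longleftrightarrow>
        (\<exists>l :: nat \<Rightarrow> real.
          (\<forall>j\<in>J i. a i j \<bullet> x - b i j + C * l j > 0) \<and>
          (\<forall>j\<in>J i. l j \<in> {0, 1}) \<and>
          (\<Sum>j\<in>J i. l j) \<le> real (card (J i)) - 1)"
      by (intro big_M_disjunction J(1)[OF i])
    ultimately show "x \<in> ?D - blocked_region (J i) (a i) (b i) \<longleftrightarrow>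
        (\<exists>l :: nat \<Rightarrow> real.
          (\<forall>j\<in>J i. a i j \<bullet> x - b i j + C * l j > 0) \<and>
          (\<forall>j\<in>J i. l j \<in> {0, 1}) \<and>
          (\<Sum>j\<in>J i. l j) \<le> real (card (J i)) - 1 \<and>
          x \<in> ?D)"
      by (cases "x \<in> ?D") auto
  qed
qed

end
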